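(* Let $F$ be a field of characteristic different from $2$ and let $J_2$ be the Jordan algebra of the two-dimensional vector space with non-degenerate symmetric bilinear form, with basis $\{1,e_1,e_2\}$ and commutative multiplication in which $1$ is the unit, $e_1^2=e_2^2=1$, $e_1e_2=0$. Let $c(x,y_1,y_2,y_3)\in F\langle x,y_1,y_2,y_3\rangle$ be Formanek's central polynomial for $3\times 3$ matrices (defined in the context). Then $c(x,y_1,y_2,y_3)$ is a weak polynomial identity for the pair $({\mathcal M}(J_2),{\mathcal R}(J_2))$, while $c(x,y_1,y_2,y_3y_4)$ is an essential central polynomial (of degree $10$) for the pair $({\mathcal M}(J_2),{\mathcal R}(J_2))$.
   Context: ${\mathcal R}(J_2)\subset\mathrm{End}_F(J_2)$ is the span of the multiplication operators $r(a):u\mapsto ua$, $a\in J_2$, and ${\mathcal M}(J_2)$ is the associative subalgebra of $\mathrm{End}_F(J_2)$ generated by it. For an associative algebra $R$ generated by a subspace $V$, a polynomial in the free associative algebra is a weak polynomial identity for $(R,V)$ if all its evaluations on elements of $V$ are zero; it is an essential (weak) central polynomial for the pair $(R,V)$ if all its evaluations on elements of $V$ lie in the center of $R$ and at least one such evaluation is nonzero. Formanek's polynomial: let $\theta:F[u_1,u_2,u_3,u_4]\to F\langle x,y_1,y_2,y_3\rangle$ be the linear map sending the monomial $u_1^{n_1}u_2^{n_2}u_3^{n_3}u_4^{n_4}$ to $x^{n_1}y_1x^{n_2}y_2x^{n_3}y_3x^{n_4}$; write $\theta(p)(x,z_1,z_2,z_3)$ for the result of substituting $z_i$ for $y_i$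 in $\theta(p)$. Let $p=(u_1-u_2)(u_1-u_3)(u_4-u_2)(u_4-u_3)(u_2-u_3)^2$. Then \[ c(x,y_1,y_2,y_3)=\theta(p)(x,y_1,y_2,y_3)+\theta(p)(x,y_2,y_3,y_1)+\theta(p)(x,y_3,y_1,y_2), \] which is a central polynomial for $M_3(F)$ over every field $F$. *)

theory Defs
  imports Complex_Main "HOL-Library.Poly_Mapping"
begin

section \<open>Free associative algebras\<close>

text \<open>Words are wrapped lists, so that concatenation can be the addition of a
  \<^class>\<open>monoid_add\<close>. The multiplication of finitely supported functions on
  words is then convolution, which is the product of the free associative algebra.\<close>

datatype 'v word = Word (letters: "'v list")

instantiation word :: (type) monoid_add
begin

definition zero_word_def: "0 = Word []"
definition plus_word_def: "v + w = Word (letters v @ letters w)"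

instance
  by standard (auto simp: zero_word_def plus_word_def)

end

type_synonym ('v, 'a) free_alg = "'v word \<Rightarrow>\<^sub>0 'a"

definition gen :: "'v \<Rightarrow> ('v, 'a::field) free_alg" where
  "gen v = Poly_Mapping.single (Word [v]) 1"

definition free_scale :: "'a::field \<Rightarrow> ('v, 'a) free_alg \<Rightarrow> ('v, 'a) free_alg" where
  "free_scale a f = Poly_Mapping.single 0 a * f"

text \<open>Total degree, with value 0 on the zero polynomial.\<close>

definition free_degree :: "('v, 'a::field) free_alg \<Rightarrow> nat" where
  "free_degree f = Max (insert 0 ((\<lambda>w. length (letters w)) ` Poly_Mapping.keys f))"


section \<open>Weak identities and essential central polynomials\<close>

locale assoc_algebra = vector_space scale
  for scale :: "'a::field \<Rightarrow> 'r::ring_1 \<Rightarrow> 'r" +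
  assumes scale_mult_left: "scale a (x * y) = scale a x * y"
    and scale_mult_right: "scale a (x * y) = x * scale a y"
begin

definition subalgebra :: "'r set \<Rightarrow> bool" where
  "subalgebra A \<longleftrightarrow> subspace A \<and> (\<forall>x\<in>A. \<forall>y\<in>A. x * y \<in> A)"

definition generated :: "'r set \<Rightarrow> 'r set" where
  "generated S = \<Inter>{A. subalgebra A \<and> S \<subseteq> A}"

definition center :: "'r set \<Rightarrow> 'r set" where
  "center R = {z\<in>R. \<forall>x\<in>R. z * x = x * z}"

definition eval :: "('v \<Rightarrow> 'r) \<Rightarrow> ('v, 'a) free_alg \<Rightarrow> 'r" where
  "eval \<rho> f = (\<Sum>w\<in>Poly_Mapping.keys f.
     scale (Poly_Mapping.lookup f w) (prod_list (map \<rho> (letters w))))"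

definition algebra_pair :: "'r set \<Rightarrow> 'r set \<Rightarrow> bool" where
  "algebra_pair R V \<longleftrightarrow> subspace V \<and> R = generated V"

definition weak_identity :: "'r set \<Rightarrow> 'r set \<Rightarrow> ('v, 'a) free_alg \<Rightarrow> bool" where
  "weak_identity R V f \<longleftrightarrow> algebra_pair R V \<and>
     (\<forall>\<rho>. range \<rho> \<subseteq> V \<longrightarrow> eval \<rho> f = 0)"

definition essential_central :: "'r set \<Rightarrow> 'r set \<Rightarrow> ('v, 'a) free_alg \<Rightarrow> bool" where
  "essential_central R V f \<longleftrightarrow> algebra_pair R V \<and>
     (\<forall>\<rho>. range \<rho> \<subseteq> V \<longrightarrow> eval \<rho> f \<in> center R) \<and>
     (\<exists>\<rho>. range \<rho> \<subseteq> V \<and> eval \<rho> f \<noteq> 0)"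

end

interpretation free: assoc_algebra "free_scale :: 'a::field \<Rightarrow> ('v, 'a) free_alg \<Rightarrow> _"
proof
  fix a b :: 'a and x y :: "('v, 'a) free_alg"
  show "free_scale a (x + y) = free_scale a x + free_scale a y"
    by (simp add: free_scale_def algebra_simps)
  show "free_scale (a + b) x = free_scale a x + free_scale b x"
    by (simp add: free_scale_def single_add algebra_simps)
  show "free_scale a (free_scale b x) = free_scale (a * b) x"
    by (simp add: free_scale_def mult_single mult.assoc[symmetric])
  show "free_scale 1 x = x"
    by (simp add: free_scale_def)
  show "free_scale a (x * y) = free_scale a x * y"
    by (simp add: free_scale_def mult.assoc)
  have commute: "Poly_Mapping.single 0 a * x = x * Poly_Mapping.single 0 a"
  proof (induction x rule: update_induct)
    case (update f w b)
    have "Poly_Mapping.update w b f = f + Poly_Mapping.single w b"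
      using update.hyps
      by (intro poly_mapping_eqI)
        (auto simp: lookup_update lookup_add lookup_single in_keys_iff when_def)
    then show ?case
      using update.IH by (simp add: algebra_simps mult_single mult.commute)
  qed simp
  show "free_scale a (x * y) = x * free_scale a y"
    by (simp add: free_scale_def commute mult.assoc[symmetric])
qed

abbreviation subst :: "('v \<Rightarrow> ('w, 'a) free_alg) \<Rightarrow> ('v, 'a::field) free_alg \<Rightarrow> ('w, 'a) free_alg" where
  "subst \<equiv> free.eval"


section \<open>The Jordan algebra of a two-dimensional bilinear form\<close>

text \<open>\<open>J2 a b c\<close> stands for \<open>a 1 + b e\<^sub>1 + c e\<^sub>2\<close>.\<close>

datatype 'a j2 = J2 (c0: 'a) (c1: 'a) (c2: 'a)

instantiation j2 :: (field) "{ab_group_add, one, times}"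
begin

definition zero_j2_def: "0 = J2 0 0 0"
definition one_j2_def: "1 = J2 1 0 0"
definition plus_j2_def: "u + v = J2 (c0 u + c0 v) (c1 u + c1 v) (c2 u + c2 v)"
definition uminus_j2_def: "- u = J2 (- c0 u) (- c1 u) (- c2 u)"
definition minus_j2_def: "u - v = J2 (c0 u - c0 v) (c1 u - c1 v) (c2 u - c2 v)"
definition times_j2_def:
  "u * v = J2 (c0 u * c0 v + c1 u * c1 v + c2 u * c2 v)
              (c0 u * c1 v + c1 u * c0 v)
              (c0 u * c2 v + c2 u * c0 v)"

instance
  by standard
    (auto simp: zero_j2_def plus_j2_def uminus_j2_def minus_j2_def algebra_simps j2.expand)

end

lemmas j2_defs = zero_j2_def one_j2_def plus_j2_def uminus_j2_def minus_j2_def times_j2_def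

definition e1 :: "'a::field j2" where "e1 = J2 0 1 0"
definition e2 :: "'a::field j2" where "e2 = J2 0 0 1"

definition j2_scale :: "'a::field \<Rightarrow> 'a j2 \<Rightarrow> 'a j2" where
  "j2_scale a u = J2 (a * c0 u) (a * c1 u) (a * c2 u)"

interpretation j2: vector_space "j2_scale :: 'a::field \<Rightarrow> _"
  by standard (auto simp: j2_scale_def j2_defs algebra_simps)

lemma j2_basis:
  "j2_scale a 1 + j2_scale b e1 + j2_scale c e2 = J2 a b c"
  by (simp add: j2_scale_def j2_defs e1_def e2_def)

lemma j2_mult_table:
  "(1::'a::field j2) * u = u" "u * 1 = u"
  "(e1::'a j2) * e1 = 1" "(e2::'a j2) * e2 = 1" "(e1::'a j2) * e2 = 0"
  by (simp_all add: j2_defs e1_def e2_def)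

lemma j2_mult_commute: "(u::'a::field j2) * v = v * u"
  by (simp add: j2_defs algebra_simps)

lemma j2_mult_bilinear:
  fixes u v w :: "'a::field j2"
  shows "(u + v) * w = u * w + v * w" "w * (u + v) = w * u + w * v"
    "j2_scale a u * w = j2_scale a (u * w)" "w * j2_scale a u = j2_scale a (w * u)"
  by (simp_all add: j2_scale_def j2_defs algebra_simps)

lemma j2_jordan_identity: "((u::'a::field j2) * v) * (u * u) = u * (v * (u * u))"
  by (simp add: j2_defs algebra_simps)


section \<open>The multiplication algebra\<close>

text \<open>Products of endomorphisms are compositions \<open>(f * g) u = f (g u)\<close>. Writing operators on
  the right instead would pass to the opposite algebra; the operators \<open>u \<mapsto> u a\<close> are symmetric
  matrices in the basis \<open>1, e\<^sub>1, e\<^sub>2\<close>, so transposition identifies the two settings.\<close>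

typedef (overloaded) ('a::field) endo =
  "{f :: 'a j2 \<Rightarrow> 'a j2. Vector_Spaces.linear j2_scale j2_scale f}"
  morphisms apply_endo Endo
  by (rule exI[of _ id]) (use j2.linear_id in simp)

setup_lifting type_definition_endo

lemma linear_j2_iff:
  "Vector_Spaces.linear j2_scale j2_scale f \<longleftrightarrow>
     (\<forall>u v. f (u + v) = f u + f v) \<and> (\<forall>a u. f (j2_scale a u) = j2_scale a (f u))"
  by (simp add: Vector_Spaces.linear_iff j2.vector_space_axioms)

instantiation endo :: (field) ring_1
begin

lift_definition zero_endo :: "'a endo" is "\<lambda>u. 0"
  by (simp add: linear_j2_iff)
lift_definition one_endo :: "'a endo" is "\<lambda>u. u"
  by (simp add: linear_j2_iff)
lift_definition plus_endo :: "'a endo \<Rightarrow> 'a endo \<Rightarrow> 'a endo" is "\<lambda>f g u. f u + g u"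
  by (simp add: linear_j2_iff j2.scale_right_distrib)
lift_definition uminus_endo :: "'a endo \<Rightarrow> 'a endo" is "\<lambda>f u. - f u"
  by (simp add: linear_j2_iff)
lift_definition minus_endo :: "'a endo \<Rightarrow> 'a endo \<Rightarrow> 'a endo" is "\<lambda>f g u. f u - g u"
  by (simp add: linear_j2_iff j2.scale_right_diff_distrib)
lift_definition times_endo :: "'a endo \<Rightarrow> 'a endo \<Rightarrow> 'a endo" is "\<lambda>f g u. f (g u)"
  by (simp add: linear_j2_iff)

instance
proof
  show "(0::'a endo) \<noteq> 1"
    by transfer (auto simp: fun_eq_iff j2_defs intro!: exI[of _ 1])
qed (transfer; simp add: linear_j2_iff fun_eq_iff algebra_simps)+

end

lift_definition endo_scale :: "'a::field \<Rightarrow> 'a endo \<Rightarrow> 'a endo" is "\<lambda>a f u. j2_scale a (f u)"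
  by (simp add: linear_j2_iff j2.scale_right_distrib mult.commute)

interpretation endo: assoc_algebra "endo_scale :: 'a::field \<Rightarrow> _"
  by standard
    (transfer; simp add: linear_j2_iff fun_eq_iff j2.scale_right_distrib j2.scale_left_distrib)+

lift_definition mult_op :: "'a::field j2 \<Rightarrow> 'a endo" is "\<lambda>a u. u * a"
  by (simp add: linear_j2_iff j2_mult_bilinear)

definition R_J2 :: "'a::field endo set" where
  "R_J2 = endo.span (range mult_op)"

definition M_J2 :: "'a::field endo set" where
  "M_J2 = endo.generated R_J2"

text \<open>Generated subalgebras are not required to be unital; here the identity belongs to
  the generating space, so this makes no difference.\<close>

lemma one_in_R_J2: "1 \<in> R_J2"
proof -
  have "mult_op 1 = 1"
    by transfer (simp add: j2_mult_table)
  then show ?thesis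
    unfolding R_J2_def by (metis endo.span_base rangeI)
qed


section \<open>Formanek's polynomial\<close>

datatype uvar = U1 | U2 | U3 | U4

type_synonym 'a upoly = "(uvar \<Rightarrow>\<^sub>0 nat) \<Rightarrow>\<^sub>0 'a"

definition ugen :: "uvar \<Rightarrow> 'a::field upoly" where
  "ugen i = Poly_Mapping.single (Poly_Mapping.single i 1) 1"

text \<open>The variables \<open>y\<^sub>1, y\<^sub>2, \<dots>\<close> are \<open>Y 1, Y 2, \<dots>\<close>; all polynomials live in the free
  algebra on \<open>x\<close> and countably many \<open>y\<^sub>i\<close>.\<close>

datatype xyvar = X | Y nat

definition theta_word :: "(uvar \<Rightarrow>\<^sub>0 nat) \<Rightarrow> xyvar word" where
  "theta_word n = Word
     (replicate (Poly_Mapping.lookup n U1) X @ [Y 1] @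
      replicate (Poly_Mapping.lookup n U2) X @ [Y 2] @
      replicate (Poly_Mapping.lookup n U3) X @ [Y 3] @
      replicate (Poly_Mapping.lookup n U4) X)"

definition theta :: "'a::field upoly \<Rightarrow> (xyvar, 'a) free_alg" where
  "theta p = (\<Sum>n\<in>Poly_Mapping.keys p.
     Poly_Mapping.single (theta_word n) (Poly_Mapping.lookup p n))"

lemma theta_single: "theta (Poly_Mapping.single n a) = Poly_Mapping.single (theta_word n) a"
  by (cases "a = 0") (simp_all add: theta_def)

lemma theta_add: "theta (p + q) = theta p + theta q"
proof -
  let ?t = "\<lambda>p n. Poly_Mapping.single (theta_word n) (Poly_Mapping.lookup p n)"
  let ?K = "Poly_Mapping.keys p \<union> Poly_Mapping.keys q"
  have theta: "theta r = (\<Sum>n\<in>?K. ?t r n)" if "Poly_Mapping.keys r \<subseteq> ?K" for r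
    unfolding theta_def using that
    by (intro sum.mono_neutral_left) (auto simp: in_keys_iff)
  have "Poly_Mapping.keys (p + q) \<subseteq> ?K"
    by (rule Poly_Mapping.keys_add)
  then show ?thesis
    by (simp add: theta lookup_add single_add sum.distrib)
qed

definition theta_at :: "'a::field upoly \<Rightarrow> (xyvar, 'a) free_alg \<Rightarrow> (xyvar, 'a) free_alg \<Rightarrow>
    (xyvar, 'a) free_alg \<Rightarrow> (xyvar, 'a) free_alg" where
  "theta_at p z1 z2 z3 = subst (gen(Y 1 := z1, Y 2 := z2, Y 3 := z3)) (theta p)"

definition formanek_p :: "'a::field upoly" where
  "formanek_p =
     (ugen U1 - ugen U2) * (ugen U1 - ugen U3) * (ugen U4 - ugen U2) * (ugen U4 - ugen U3) *
     (ugen U2 - ugen U3)\<^sup>2"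

definition formanek_c :: "(xyvar, 'a::field) free_alg" where
  "formanek_c =
     theta_at formanek_p (gen (Y 1)) (gen (Y 2)) (gen (Y 3)) +
     theta_at formanek_p (gen (Y 2)) (gen (Y 3)) (gen (Y 1)) +
     theta_at formanek_p (gen (Y 3)) (gen (Y 1)) (gen (Y 2))"

end

theory Submission
  imports Defs
begin

text \<open>Writing \<open>p\<close> in the differences of consecutive \<open>u\<^sub>i\<close>, which act on the arguments of \<open>\<theta>\<close> as
  \<open>ad x\<close>, gives, with a prime for \<open>ad x\<close>,
  \<open>\<theta>(p)(x,z\<^sub>1,z\<^sub>2,z\<^sub>3) = z\<^sub>1'' z\<^sub>2'' z\<^sub>3'' + z\<^sub>1'' z\<^sub>2''' z\<^sub>3' + z\<^sub>1' z\<^sub>2''' z\<^sub>3'' + z\<^sub>1' z\<^sub>2'''' z\<^sub>3'\<close>.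
  All commutators of elements of \<open>R_J2\<close> are multiples of one fixed matrix, so for \<open>x, y\<^sub>1, y\<^sub>2\<close> in
  \<open>R_J2\<close> and an arbitrary matrix \<open>Z\<close> the value \<open>c(x,y\<^sub>1,y\<^sub>2,Z)\<close> is a multiple of a single
  expression linear in \<open>Z\<close>. That expression is the scalar \<open>2 D tr(P Z)\<close>, where \<open>x\<close> is
  multiplication by \<open>s + a e\<^sub>1 + b e\<^sub>2\<close>, \<open>D = a\<^sup>2 + b\<^sup>2\<close> and \<open>P\<close> is block diagonal with blocks \<open>D\<close>
  and \<open>- v v\<^sup>T\<close> for \<open>v = (a,b)\<close>. The trace vanishes for \<open>Z\<close> in \<open>R_J2\<close>, but not when \<open>x\<close> is
  multiplication by \<open>e\<^sub>1\<close> and \<open>Z\<close> the square of multiplication by \<open>e\<^sub>2\<close>.\<close>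

section \<open>Evaluation is a homomorphism\<close>

text \<open>Reduces additive statements about polynomials to monomials.\<close>

lemma poly_mapping_single_add_induct [case_names zero single add]:
  assumes "P 0" "\<And>k a. P (Poly_Mapping.single k a)" "\<And>f g. P f \<Longrightarrow> P g \<Longrightarrow> P (f + g)"
  shows "P (f :: 'k \<Rightarrow>\<^sub>0 'b::monoid_add)"
proof (induction f rule: update_induct)
  case (update f k b)
  have "Poly_Mapping.update k b f = f + Poly_Mapping.single k b"
    using update.hyps
    by (intro poly_mapping_eqI)
      (auto simp: lookup_update lookup_add lookup_single in_keys_iff when_def)
  then show ?case
    using assms update.IH by simp
qed (fact assms(1))

context assoc_algebra
begin

lemma eval_superset:
  assumes "finite K" "Poly_Mapping.keys f \<subseteq> K"
  shows "eval \<rho> f = (\<Sum>w\<in>K. scale (Poly_Mapping.lookup f w) (prod_list (map \<rho> (letters w))))"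
  unfolding eval_def using assms
  by (intro sum.mono_neutral_left) (auto simp: in_keys_iff)

lemma eval_single:
  "eval \<rho> (Poly_Mapping.single w a) = scale a (prod_list (map \<rho> (letters w)))"
  by (subst eval_superset[of "{w}"]) auto

lemma eval_gen: "eval \<rho> (gen v) = \<rho> v"
  by (simp add: gen_def eval_single)

lemma eval_zero: "eval \<rho> 0 = 0"
  by (simp add: eval_def)

lemma eval_add: "eval \<rho> (f + g) = eval \<rho> f + eval \<rho> g"
proof -
  let ?K = "Poly_Mapping.keys f \<union> Poly_Mapping.keys g"
  have "Poly_Mapping.keys (f + g) \<subseteq> ?K"
    by (rule Poly_Mapping.keys_add)
  then show ?thesis
    by (simp add: eval_superset[of ?K] lookup_add scale_left_distrib sum.distrib)
qed

lemma eval_diff: "eval \<rho> (f - g) = eval \<rho> f - eval \<rho> g"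
  using eval_add[of \<rho> "f - g" g] by simp

text \<open>By additivity in both factors only monomials matter; there convolution concatenates
  words and \<open>prod_list\<close> splits accordingly.\<close>

lemma eval_mult: "eval \<rho> (f * g) = eval \<rho> f * eval \<rho> g"
proof (induction f rule: poly_mapping_single_add_induct)
  case (single v a)
  show ?case
  proof (induction g rule: poly_mapping_single_add_induct)
    case (single w b)
    show ?case
      by (simp add: mult_single eval_single plus_word_def scale_mult_left[symmetric]
          scale_mult_right[symmetric])
  qed (simp_all add: eval_zero eval_add distrib_left)
qed (simp_all add: eval_zero eval_add distrib_right)

lemma generated_subalgebra: "subalgebra (generated S)"
  unfolding generated_def subalgebra_def
  by (auto simp: subspace_def)

lemma generated_superset: "S \<subseteq> generated S"
  by (auto simp: generated_def)

end


section \<open>Formanek's polynomial in terms of commutators\<close>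

definition ad :: "'r::ring \<Rightarrow> 'r \<Rightarrow> 'r" where
  "ad x y = x * y - y * x"

text \<open>Stated over any ring, so that one formula serves both the free algebra and its values in
  \<open>endo\<close>.\<close>

definition formanek_ad :: "'r::ring \<Rightarrow> 'r \<Rightarrow> 'r \<Rightarrow> 'r \<Rightarrow> 'r" where
  "formanek_ad x z1 z2 z3 =
     ad x (ad x z1) * ad x (ad x z2) * ad x (ad x z3) +
     ad x (ad x z1) * ad x (ad x (ad x z2)) * ad x z3 +
     ad x z1 * ad x (ad x (ad x z2)) * ad x (ad x z3) +
     ad x z1 * ad x (ad x (ad x (ad x z2))) * ad x z3"

definition formanek_cyclic :: "'r::ring \<Rightarrow> 'r \<Rightarrow> 'r \<Rightarrow> 'r \<Rightarrow> 'r" where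
  "formanek_cyclic x z1 z2 z3 =
     formanek_ad x z1 z2 z3 + formanek_ad x z2 z3 z1 + formanek_ad x z3 z1 z2"

lemma (in assoc_algebra) eval_formanek_cyclic:
  "eval \<rho> (formanek_cyclic x z1 z2 z3) =
     formanek_cyclic (eval \<rho> x) (eval \<rho> z1) (eval \<rho> z2) (eval \<rho> z3)"
  by (simp add: formanek_cyclic_def formanek_ad_def ad_def eval_add eval_diff eval_mult)

lemma theta_at_single:
  "theta_at (Poly_Mapping.single n a) z1 z2 z3 =
     free_scale a (gen X ^ Poly_Mapping.lookup n U1 * z1 * gen X ^ Poly_Mapping.lookup n U2 * z2 *
       gen X ^ Poly_Mapping.lookup n U3 * z3 * gen X ^ Poly_Mapping.lookup n U4)"
  by (simp add: theta_at_def theta_single free.eval_single theta_word_def prod_list_replicate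
      mult.assoc)

lemma theta_at_zero: "theta_at 0 z1 z2 z3 = 0"
  by (simp add: theta_at_def theta_def free.eval_zero)

lemma theta_at_add: "theta_at (p + q) z1 z2 z3 = theta_at p z1 z2 z3 + theta_at q z1 z2 z3"
  by (simp add: theta_at_def theta_add free.eval_add)

lemma theta_at_one: "theta_at 1 z1 z2 z3 = z1 * z2 * z3"
  using theta_at_single[of 0 1 z1 z2 z3] by simp

text \<open>Multiplying by \<open>u\<^sub>i\<close> inserts a factor \<open>x\<close> into the \<open>i\<close>-th gap, so a difference of adjacent
  variables acts as \<open>ad x\<close> on the argument between the two gaps.\<close>

lemma theta_at_diff_mult:
  fixes p :: "'a::field upoly"
  shows "theta_at ((ugen U1 - ugen U2) * p) z1 z2 z3 = theta_at p (ad (gen X) z1) z2 z3"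
    and "theta_at ((ugen U2 - ugen U3) * p) z1 z2 z3 = theta_at p z1 (ad (gen X) z2) z3"
    and "theta_at ((ugen U3 - ugen U4) * p) z1 z2 z3 = theta_at p z1 z2 (ad (gen X) z3)"
proof -
  have diff: "theta_at (q - r) z1 z2 z3 = theta_at q z1 z2 z3 - theta_at r z1 z2 z3"
    for q r :: "'a upoly"
    using theta_at_add[of "q - r" r z1 z2 z3] by simp
  note simps = ad_def diff left_diff_distrib right_diff_distrib ugen_def mult_single
    theta_at_single lookup_add lookup_single free.scale_right_diff_distrib
    power_Suc power_commutes mult.assoc
  have pow: "gen X ^ n * (gen X * z) = gen X * (gen X ^ n * z)"
    for n and z :: "(xyvar, 'a) free_alg"
    by (metis mult.assoc power_commutes)
  show "theta_at ((ugen U1 - ugen U2) * p) z1 z2 z3 = theta_at p (ad (gen X) z1) z2 z3"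
  proof (induction p rule: poly_mapping_single_add_induct)
    case (single k a)
    then show ?case by (simp add: simps pow)
  qed (simp_all add: theta_at_zero theta_at_add distrib_left)
  show "theta_at ((ugen U2 - ugen U3) * p) z1 z2 z3 = theta_at p z1 (ad (gen X) z2) z3"
  proof (induction p rule: poly_mapping_single_add_induct)
    case (single k a)
    then show ?case by (simp add: simps pow)
  qed (simp_all add: theta_at_zero theta_at_add distrib_left)
  show "theta_at ((ugen U3 - ugen U4) * p) z1 z2 z3 = theta_at p z1 z2 (ad (gen X) z3)"
  proof (induction p rule: poly_mapping_single_add_induct)
    case (single k a)
    then show ?case by (simp add: simps pow)
  qed (simp_all add: theta_at_zero theta_at_add distrib_left)
qed

lemma theta_at_formanek_p:
  fixes z1 z2 z3 :: "(xyvar, 'a::field) free_alg"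
  shows "theta_at formanek_p z1 z2 z3 = formanek_ad (gen X) z1 z2 z3"
proof -
  define \<alpha> \<beta> \<gamma> :: "'a upoly"
    where "\<alpha> = ugen U1 - ugen U2" and "\<beta> = ugen U2 - ugen U3" and "\<gamma> = ugen U3 - ugen U4"
  have "formanek_p = \<alpha> * (\<alpha> + \<beta>) * (\<beta> + \<gamma>) * \<gamma> * \<beta>\<^sup>2"
  proof -
    \<comment> \<open>The two minus signs from the \<open>U4\<close> factors cancel.\<close>
    have "ugen U1 - ugen U3 = \<alpha> + \<beta>" "ugen U4 - ugen U2 = - (\<beta> + \<gamma>)" "ugen U4 - ugen U3 = - \<gamma>"
      by (simp_all add: \<alpha>_def \<beta>_def \<gamma>_def)
    then show ?thesis
      by (simp only: formanek_p_def mult_minus_left mult_minus_right minus_minus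
          flip: \<alpha>_def \<beta>_def)
  qed
  \<comment> \<open>Nested to the right and ending in 1, so that each factor can be peeled off in
    turn as an \<open>ad (gen X)\<close>.\<close>
  also have "\<dots> = \<alpha> * (\<alpha> * (\<beta> * (\<beta> * (\<gamma> * (\<gamma> * 1))))) + \<alpha> * (\<alpha> * (\<beta> * (\<beta> * (\<beta> * (\<gamma> * 1))))) +
      \<alpha> * (\<beta> * (\<beta> * (\<beta> * (\<gamma> * (\<gamma> * 1))))) + \<alpha> * (\<beta> * (\<beta> * (\<beta> * (\<beta> * (\<gamma> * 1)))))"
    by (simp add: algebra_simps power2_eq_square)
  finally have formanek_p: "formanek_p = \<dots>" .
  show ?thesis
    by (simp only: formanek_p theta_at_add \<alpha>_def \<beta>_def \<gamma>_def theta_at_diff_mult theta_at_one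
        formanek_ad_def)
qed

lemma formanek_c_eq:
  "formanek_c = formanek_cyclic (gen X) (gen (Y 1)) (gen (Y 2)) (gen (Y 3))"
  by (simp add: formanek_c_def theta_at_formanek_p formanek_cyclic_def)


section \<open>Homogeneity\<close>

definition homogeneous :: "nat \<Rightarrow> ('v, 'a::field) free_alg \<Rightarrow> bool" where
  "homogeneous d f \<longleftrightarrow> (\<forall>w\<in>Poly_Mapping.keys f. length (letters w) = d)"

lemma homogeneous_gen: "homogeneous 1 (gen v)"
  by (simp add: homogeneous_def gen_def)

lemma homogeneous_add: "homogeneous d f \<Longrightarrow> homogeneous d g \<Longrightarrow> homogeneous d (f + g)"
  unfolding homogeneous_def using Poly_Mapping.keys_add[of f g] by blast

lemma homogeneous_diff: "homogeneous d f \<Longrightarrow> homogeneous d g \<Longrightarrow> homogeneous d (f - g)"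
  unfolding homogeneous_def by (meson UnE keys_diff subsetD)

lemma homogeneous_mult: "homogeneous d f \<Longrightarrow> homogeneous e g \<Longrightarrow> homogeneous (d + e) (f * g)"
  unfolding homogeneous_def using keys_mult[of f g] by (force simp: plus_word_def)

lemma homogeneous_ad: "homogeneous d f \<Longrightarrow> homogeneous e g \<Longrightarrow> homogeneous (d + e) (ad f g)"
  unfolding ad_def
  by (metis add.commute homogeneous_diff homogeneous_mult)

text \<open>Every summand contains exactly six applications of \<open>ad x\<close>, each adding 1 to
  the degree.\<close>

lemma homogeneous_formanek_ad:
  assumes "homogeneous 1 x" "homogeneous d1 z1" "homogeneous d2 z2" "homogeneous d3 z3"
  shows "homogeneous (6 + d1 + d2 + d3) (formanek_ad x z1 z2 z3)"
proof -
  note ad = homogeneous_ad[OF assms(1)]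
  show ?thesis
    unfolding formanek_ad_def
    using homogeneous_mult[OF homogeneous_mult[OF ad[OF ad[OF assms(2)]]
          ad[OF ad[OF assms(3)]]] ad[OF ad[OF assms(4)]]]
      homogeneous_mult[OF homogeneous_mult[OF ad[OF ad[OF assms(2)]]
          ad[OF ad[OF ad[OF assms(3)]]]] ad[OF assms(4)]]
      homogeneous_mult[OF homogeneous_mult[OF ad[OF assms(2)]
          ad[OF ad[OF ad[OF assms(3)]]]] ad[OF ad[OF assms(4)]]]
      homogeneous_mult[OF homogeneous_mult[OF ad[OF assms(2)]
          ad[OF ad[OF ad[OF ad[OF assms(3)]]]]] ad[OF assms(4)]]
    by (intro homogeneous_add) (simp_all add: algebra_simps eval_nat_numeral)
qed

lemma homogeneous_formanek_cyclic:
  assumes "homogeneous 1 x" "homogeneous d1 z1" "homogeneous d2 z2" "homogeneous d3 z3"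
  shows "homogeneous (6 + d1 + d2 + d3) (formanek_cyclic x z1 z2 z3)"
  unfolding formanek_cyclic_def
  using homogeneous_formanek_ad[OF assms] homogeneous_formanek_ad[OF assms(1,3,4,2)]
    homogeneous_formanek_ad[OF assms(1,4,2,3)]
  by (intro homogeneous_add) (simp_all add: algebra_simps)

lemma free_degree_homogeneous:
  assumes "homogeneous d f" "f \<noteq> 0"
  shows "free_degree f = d"
proof -
  have "(\<lambda>w. length (letters w)) ` Poly_Mapping.keys f = {d}"
    using assms by (simp add: homogeneous_def image_constant_conv cong: image_cong)
  then show ?thesis
    by (simp add: free_degree_def)
qed


section \<open>Endomorphisms of \<open>J2\<close> as matrices\<close>

lift_definition mat3 :: "'a::field \<Rightarrow> 'a \<Rightarrow> 'a \<Rightarrow> 'a \<Rightarrow> 'a \<Rightarrow> 'a \<Rightarrow> 'a \<Rightarrow> 'a \<Rightarrow> 'a \<Rightarrow> 'a endo"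
  is "\<lambda>m00 m01 m02 m10 m11 m12 m20 m21 m22 u.
        J2 (m00 * c0 u + m01 * c1 u + m02 * c2 u)
           (m10 * c0 u + m11 * c1 u + m12 * c2 u)
           (m20 * c0 u + m21 * c1 u + m22 * c2 u)"
  by (simp add: linear_j2_iff j2_scale_def j2_defs algebra_simps)

text \<open>The columns are the images of \<open>1\<close>, \<open>e1\<close>,
  \<open>e2\<close>.\<close>

lemma mat3_cases:
  obtains m00 m01 m02 m10 m11 m12 m20 m21 m22
  where "Z = mat3 m00 m01 m02 m10 m11 m12 m20 m21 m22"
proof -
  let ?c = "\<lambda>u. apply_endo Z u"
  have lin: "apply_endo Z (u + v) = apply_endo Z u + apply_endo Z v"
    "apply_endo Z (j2_scale a u) = j2_scale a (apply_endo Z u)" for u v a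
    by (transfer, simp add: linear_j2_iff)+
  have "apply_endo Z u = apply_endo (mat3 (c0 (?c 1)) (c0 (?c e1)) (c0 (?c e2))
    (c1 (?c 1)) (c1 (?c e1)) (c1 (?c e2)) (c2 (?c 1)) (c2 (?c e1)) (c2 (?c e2))) u" for u
  proof -
    have "u = j2_scale (c0 u) 1 + j2_scale (c1 u) e1 + j2_scale (c2 u) e2"
      by (simp add: j2_basis)
    then have "apply_endo Z u = j2_scale (c0 u) (apply_endo Z 1) +
        j2_scale (c1 u) (apply_endo Z e1) + j2_scale (c2 u) (apply_endo Z e2)"
      by (metis lin)
    then show ?thesis
      by (simp add: mat3.rep_eq j2_scale_def plus_j2_def mult.commute)
  qed
  then show ?thesis
    using that by (metis apply_endo_inject ext)
qed

lemma mat3_mult: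
  "mat3 a b c d e f g h i * mat3 a' b' c' d' e' f' g' h' i' =
     mat3 (a*a' + b*d' + c*g') (a*b' + b*e' + c*h') (a*c' + b*f' + c*i')
          (d*a' + e*d' + f*g') (d*b' + e*e' + f*h') (d*c' + e*f' + f*i')
          (g*a' + h*d' + i*g') (g*b' + h*e' + i*h') (g*c' + h*f' + i*i')"
  by transfer (simp add: fun_eq_iff algebra_simps)

lemma mat3_add:
  "mat3 a b c d e f g h i + mat3 a' b' c' d' e' f' g' h' i' =
     mat3 (a + a') (b + b') (c + c') (d + d') (e + e') (f + f') (g + g') (h + h') (i + i')"
  by transfer (simp add: fun_eq_iff plus_j2_def algebra_simps)

lemma mat3_diff:
  "mat3 a b c d e f g h i - mat3 a' b' c' d' e' f' g' h' i' =
     mat3 (a - a') (b - b') (c - c') (d - d') (e - e') (f - f') (g - g') (h - h') (i - i')"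
  by transfer (simp add: fun_eq_iff minus_j2_def algebra_simps)

lemma mat3_scale:
  "endo_scale k (mat3 a b c d e f g h i) =
     mat3 (k*a) (k*b) (k*c) (k*d) (k*e) (k*f) (k*g) (k*h) (k*i)"
  by transfer (simp add: fun_eq_iff j2_scale_def algebra_simps)

lemma one_endo_mat3: "1 = mat3 1 0 0 0 1 0 0 0 1"
  by transfer (simp add: fun_eq_iff)

lemma mult_op_mat3: "mult_op (J2 p q r) = mat3 p q r q p 0 r 0 p"
  by transfer (simp add: fun_eq_iff times_j2_def algebra_simps)

lemmas mat3_arith = mat3_mult mat3_add mat3_diff mat3_scale one_endo_mat3

lemma ad_scale: "ad x (endo_scale k y) = endo_scale k (ad x y)"
  by (simp add: ad_def endo.scale_right_diff_distrib
      flip: endo.scale_mult_left endo.scale_mult_right)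

text \<open>\<open>mult_op\<close> is linear, so its range is already a subspace.\<close>

lemma R_J2_eq_range_mult_op: "R_J2 = range mult_op"
proof -
  have "endo.subspace (range mult_op)"
  proof (rule endo.subspaceI)
    have "mult_op 0 = 0"
      by transfer (simp add: j2_defs)
    then show "0 \<in> range mult_op"
      by (metis rangeI)
    have "mult_op (u + v) = mult_op u + mult_op v" for u v
      by transfer (simp add: j2_mult_bilinear)
    then show "f + g \<in> range mult_op" if "f \<in> range mult_op" "g \<in> range mult_op" for f g
      using that by (metis (no_types, lifting) imageE rangeI)
    have "mult_op (j2_scale a u) = endo_scale a (mult_op u)" for a u
      by transfer (simp add: j2_mult_bilinear)
    then show "endo_scale a f \<in> range mult_op" if "f \<in> range mult_op" for a f
      using that by (metis (no_types, lifting) imageE rangeI)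
  qed
  then show ?thesis
    by (simp add: R_J2_def endo.span_eq_iff)
qed

text \<open>All commutators of multiplication operators are multiples of the rotation \<open>E\<close>, and
  \<open>(ad x)\<^sup>2 E = (a\<^sup>2 + b\<^sup>2) E\<close> for \<open>x = mult_op (J2 s a b)\<close>.\<close>

lemma formanek_cyclic_mult_op:
  fixes s a b :: "'a::field"
  shows "formanek_cyclic (mult_op (J2 s a b)) (mult_op (J2 p1 q1 r1)) (mult_op (J2 p2 q2 r2))
      (mat3 m00 m01 m02 m10 m11 m12 m20 m21 m22) =
    endo_scale (2 * (a * r1 - b * q1) * (a * r2 - b * q2) * (a^2 + b^2) *
      ((a^2 + b^2) * m00 - a^2 * m11 - a * b * (m12 + m21) - b^2 * m22)) 1"
proof -
  define x where "x = mult_op (J2 s a b)"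
  define E :: "'a endo" where "E = mat3 0 0 0 0 0 1 0 (-1) 0"
  define w :: "'a endo" where "w = mat3 0 (- b) a (- b) 0 0 a 0 0"
  define D where "D = a^2 + b^2"
  have ad1: "ad x (mult_op (J2 p q r)) = endo_scale (a * r - b * q) E" for p q r
    by (simp add: x_def E_def ad_def mult_op_mat3 mat3_arith algebra_simps)
  have adE: "ad x E = w"
    by (simp add: x_def E_def w_def ad_def mult_op_mat3 mat3_arith algebra_simps)
  have adw: "ad x w = endo_scale D E"
    by (simp add: x_def E_def w_def D_def ad_def mult_op_mat3 mat3_arith algebra_simps
        power2_eq_square minus_diff_commute)
  \<comment> \<open>Applied four times below, to obtain \<open>Z1\<close> to
    \<open>Z4\<close>.\<close>
  have adZ: "ad x (mat3 a0 a1 a2 b0 b1 b2 d0 d1 d2) =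
    mat3 (a*b0 + b*d0 - a*a1 - b*a2) (a*b1 + b*d1 - a*a0) (a*b2 + b*d2 - b*a0)
         (a*a0 - a*b1 - b*b2) (a*a1 - a*b0) (a*a2 - b*b0)
         (b*a0 - a*d1 - b*d2) (b*a1 - a*d0) (b*a2 - b*d0)" for a0 a1 a2 b0 b1 b2 d0 d1 d2
    by (simp add: x_def ad_def mult_op_mat3 mat3_arith algebra_simps)
  note pull = endo.scale_right_distrib endo.scale_mult_left[symmetric] endo.scale_mult_right[symmetric]
  let ?Z = "mat3 m00 m01 m02 m10 m11 m12 m20 m21 m22"
  define Z1 where "Z1 = ad x ?Z"
  define Z2 where "Z2 = ad x Z1"
  define Z3 where "Z3 = ad x Z2"
  define Z4 where "Z4 = ad x Z3"
  \<comment> \<open>The three groups of four terms have \<open>Z\<close> in last, middle and first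
    position. Up to scalars, the derivatives of \<open>y1\<close> and \<open>y2\<close> alternate
    between \<open>E\<close> and \<open>w\<close>, with a factor \<open>D\<close> every second
    time.\<close>
  define S where "S = w * w * Z2 + endo_scale D (w * E * Z1) + endo_scale D (E * E * Z2) +
    endo_scale D (E * w * Z1) + (w * Z2 * w + w * Z3 * E + E * Z3 * w + E * Z4 * E) +
    (Z2 * w * w + endo_scale D (Z2 * E * E) + endo_scale D (Z1 * E * w) + endo_scale D (Z1 * w * E))"
  have cyclic: "formanek_cyclic x (mult_op (J2 p1 q1 r1)) (mult_op (J2 p2 q2 r2)) ?Z =
      endo_scale ((a * r1 - b * q1) * (a * r2 - b * q2)) S"
    by (simp add: S_def formanek_cyclic_def formanek_ad_def ad1 ad_scale adE adw pull mult_ac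
      flip: Z1_def Z2_def Z3_def Z4_def)
  have products: "w * w = mat3 D 0 0 0 (b*b) (-(a*b)) 0 (-(a*b)) (a*a)"
    "E * E = mat3 0 0 0 0 (-1) 0 0 0 (-1)"
    "w * E = mat3 0 (-a) (-b) 0 0 0 0 0 0" "E * w = mat3 0 0 0 a 0 0 b 0 0"
    by (simp_all add: w_def E_def D_def mat3_arith power2_eq_square algebra_simps)
  have "S = endo_scale (2 * D * (D * m00 - a^2 * m11 - a * b * (m12 + m21) - b^2 * m22)) 1"
    unfolding S_def
    \<comment> \<open>Reassociating exposes the sparse products of \<open>w\<close> and
      \<open>E\<close> to the right of \<open>Z1\<close> and \<open>Z2\<close>.\<close>
    by (simp only: products mult.assoc[of Z1] mult.assoc[of Z2])
      (simp only: w_def E_def Z4_def Z3_def Z2_def Z1_def adZ mat3_arith,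
       simp add: D_def power2_eq_square algebra_simps)
  then show ?thesis
    using cyclic by (simp only: x_def D_def endo.scale_scale mult_ac)
qed

section \<open>Values on the pair \<open>(M_J2, R_J2)\<close>\<close>

lemma algebra_pair_M_J2: "endo.algebra_pair M_J2 R_J2"
  by (simp add: endo.algebra_pair_def M_J2_def R_J2_def)

lemma weak_identity_formanek_c:
  "endo.weak_identity M_J2 R_J2 (formanek_c :: (xyvar, 'a::field) free_alg)"
proof -
  have "endo.eval \<rho> (formanek_c :: (xyvar, 'a) free_alg) = 0" if "range \<rho> \<subseteq> R_J2" for \<rho>
  proof -
    have "\<exists>s p q. \<rho> v = mult_op (J2 s p q)" for v
      using that by (metis j2.exhaust R_J2_eq_range_mult_op imageE rangeI subsetD)
    then obtain s p q where \<rho>: "\<rho> v = mult_op (J2 (s v) (p v) (q v))" for v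
      by metis
    show ?thesis
      unfolding formanek_c_eq endo.eval_formanek_cyclic endo.eval_gen \<rho>
      \<comment> \<open>A multiplication operator has constant diagonal \<open>p\<close> and
        \<open>m12 = m21 = 0\<close>, so the last factor is
        \<open>(a^2 + b^2) * p - a^2 * p - b^2 * p = 0\<close>.\<close>
      by (simp only: mult_op_mat3[of "s (Y 3)"] formanek_cyclic_mult_op) (simp add: algebra_simps)
  qed
  then show ?thesis
    by (simp add: endo.weak_identity_def algebra_pair_M_J2)
qed

lemma scalar_in_center: "endo_scale (k::'a::field) 1 \<in> endo.center M_J2"
proof -
  have "endo.subspace (M_J2 :: 'a endo set)"
    using endo.generated_subalgebra by (auto simp: endo.subalgebra_def M_J2_def)
  moreover have "(1 :: 'a endo) \<in> M_J2"
    using one_in_R_J2 endo.generated_superset by (auto simp: M_J2_def)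
  ultimately show ?thesis
    by (auto simp: endo.center_def endo.subspace_scale
        simp flip: endo.scale_mult_left endo.scale_mult_right)
qed

lemma essential_central_formanek_c:
  fixes f :: "(xyvar, 'a::field) free_alg"
  assumes "CHAR('a) \<noteq> 2"
    and f: "f = formanek_cyclic (gen X) (gen (Y 1)) (gen (Y 2)) (gen (Y 3) * gen (Y 4))"
  shows "endo.essential_central M_J2 R_J2 f"
proof -
  have "endo.eval \<rho> f \<in> endo.center M_J2" if "range \<rho> \<subseteq> R_J2" for \<rho>
  proof -
    have \<rho>: "\<exists>s p q. \<rho> v = mult_op (J2 s p q)" for v
      using that by (metis j2.exhaust R_J2_eq_range_mult_op imageE rangeI subsetD)
    obtain s a b where X: "\<rho> X = mult_op (J2 s a b)"
      using \<rho> by blast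
    obtain p1 q1 r1 where Y1: "\<rho> (Y 1) = mult_op (J2 p1 q1 r1)"
      using \<rho> by blast
    obtain p2 q2 r2 where Y2: "\<rho> (Y 2) = mult_op (J2 p2 q2 r2)"
      using \<rho> by blast
    \<comment> \<open>The product may leave \<open>R_J2\<close>, but the formula allows any matrix
      in the last argument.\<close>
    obtain m00 m01 m02 m10 m11 m12 m20 m21 m22
      where "\<rho> (Y 3) * \<rho> (Y 4) = mat3 m00 m01 m02 m10 m11 m12 m20 m21 m22"
      by (rule mat3_cases)
    then show ?thesis
      unfolding f
      by (simp only: endo.eval_formanek_cyclic endo.eval_gen endo.eval_mult X Y1 Y2
          formanek_cyclic_mult_op scalar_in_center)
  qed
  \<comment> \<open>Here \<open>a = r1 = r2 = 1\<close>, \<open>b = 0\<close> and the last argument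
    is diag(1,0,1), so the scalar is \<open>2 * (m00 - m11) = 2\<close>.\<close>
  moreover have "endo.eval ((\<lambda>_. mult_op e2)(X := mult_op e1)) f \<noteq> 0"
  proof -
    have "mult_op e2 * mult_op e2 = mat3 1 0 0 0 0 0 0 0 (1::'a)"
      by (simp add: e2_def mult_op_mat3 mat3_mult)
    then have "endo.eval ((\<lambda>_. mult_op e2)(X := mult_op e1)) f = endo_scale 2 1"
      unfolding f
      by (simp add: endo.eval_formanek_cyclic endo.eval_gen endo.eval_mult)
        (simp add: e1_def e2_def formanek_cyclic_mult_op)
    moreover have "(2::'a) \<noteq> 0"
    proof
      assume "(2::'a) = 0"
      then have "CHAR('a) dvd 2"
        using of_nat_eq_0_iff_char_dvd[where ?'a = 'a, of 2] by simp
      then have "CHAR('a) \<le> 2" "CHAR('a) \<noteq> 0"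
        by (auto dest: dvd_imp_le intro!: gr0I)
      then show False
        using assms(1) CHAR_not_1[where ?'a = 'a] by linarith
    qed
    ultimately show ?thesis
      by simp
  qed
  moreover have "range ((\<lambda>_. mult_op e2)(X := mult_op e1)) \<subseteq> (R_J2 :: 'a endo set)"
    by (auto simp: R_J2_eq_range_mult_op)
  ultimately show ?thesis
    unfolding endo.essential_central_def using algebra_pair_M_J2 by blast
qed

theorem mainTheorem8:
  assumes "CHAR('a::field) \<noteq> 2"
  shows "endo.weak_identity M_J2 R_J2 (formanek_c :: (xyvar, 'a) free_alg) \<and>
    (let c' = subst (gen(Y 3 := gen (Y 3) * gen (Y 4))) (formanek_c :: (xyvar, 'a) free_alg)
     in endo.essential_central M_J2 R_J2 c' \<and> free_degree c' = 10)"
proof -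
  let ?c' = "formanek_cyclic (gen X) (gen (Y 1)) (gen (Y 2)) (gen (Y 3) * gen (Y 4)) ::
    (xyvar, 'a) free_alg"
  have c': "subst (gen(Y 3 := gen (Y 3) * gen (Y 4))) (formanek_c :: (xyvar, 'a) free_alg) = ?c'"
    by (simp add: formanek_c_eq free.eval_formanek_cyclic free.eval_gen)
  have essential: "endo.essential_central M_J2 R_J2 ?c'"
    by (rule essential_central_formanek_c[OF assms refl])
  \<comment> \<open>Excludes the default degree 0 of the zero polynomial; a nonzero value forces a
    nonzero polynomial.\<close>
  have "?c' \<noteq> 0"
    using essential endo.eval_zero by (metis endo.essential_central_def)
  moreover have "homogeneous (6 + 1 + 1 + (1 + 1)) ?c'"
    by (intro homogeneous_formanek_cyclic homogeneous_gen homogeneous_mult)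
  ultimately have "free_degree ?c' = 10"
    using free_degree_homogeneous by fastforce
  then show ?thesis
    using essential weak_identity_formanek_c by (simp add: c')
qed

end
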